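(* Let $\mathbf{A}$ be a commutative ring and $\mathbf{B}$ a commutative $\mathbf{A}$-algebra which is free of rank $n$ as an $\mathbf{A}$-module. Let $\mu:\mathbf{B}\otimes_{\mathbf{A}}\mathbf{B}\to\mathbf{B}$, $x\otimes y\mapsto xy$, let $J=\ker\mu$, and let $\delta\in\mathrm{Ann}(J)$ be arbitrary. Put $b=\mu(\delta)$. Let $\underline{\varepsilon}=(\varepsilon_1,\dots,\varepsilon_n)$ be a basis of $\mathbf{B}/\mathbf{A}$, let $T_{\underline\varepsilon}=\big(\mathrm{Tr}_{\mathbf{B}/\mathbf{A}}(\varepsilon_i\varepsilon_j)\big)_{1\le i,j\le n}$, let $\mathrm{Disc}(\underline\varepsilon)=\det(T_{\underline\varepsilon})$, and let $M_b$ be the matrix of multiplication by $b$ in the basis $\underline\varepsilon$. Write $$\delta=u_1\otimes\varepsilon_1+\cdots+u_n\otimes\varepsilon_n,\qquad u_j\in\mathbf{B},$$ and let $P_{\underline u}=(u_{ij})\in\mathbb{M}_n(\mathbf{A})$ be the matrix whose $i$-th row consists of the coordinates of $u_i$ in the basis $\underline\varepsilon$, i.e. $u_i=\sum_j u_{ij}\varepsilon_j$. Then: 1. The following two equalities hold in $\mathbb{M}_n(\mathbf{A})$: $$M_b=\big(\mathrm{Tr}_{\mathbf{B}/\mathbf{A}}(u_i\varepsilon_j)\big)_{1\le i,j\le n}=P_{\underline u}\,T_{\underline\varepsilon}.$$ 2. Consequently $\mathrm{N}_{\mathbf{B}/\mathbf{A}}(b)=\det(P_{\underline u})\,\mathrm{Disc}(\underline\varepsilon)$.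 In consequence, $\mathrm{Disc}(\mathbf{B}/\mathbf{A})$ divides $\mathrm{N}_{\mathbf{B}/\mathbf{A}}(b)$ for every $b\in\mu(\mathrm{Ann}(J))$.
   Context: $\mathrm{Ann}(J)$ is the annihilator of the ideal $J$ in the ring $\mathbf{B}\otimes_{\mathbf{A}}\mathbf{B}$. $\mathrm{Tr}_{\mathbf{B}/\mathbf{A}}(b)$ and $\mathrm{N}_{\mathbf{B}/\mathbf{A}}(b)$ are the trace and determinant of the $\mathbf{A}$-linear multiplication by $b$ on $\mathbf{B}$. The matrix $M_b$ has as its $j$-th column the coordinates of $b\varepsilon_j$ in the basis $\underline\varepsilon$. $\mathrm{Disc}(\mathbf{B}/\mathbf{A})$ denotes $\mathrm{Disc}(\underline\varepsilon)$, well defined up to the square of a unit of $\mathbf{A}$. *)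

theory Defs
  imports
    "HOL-Library.Poly_Mapping"
    "HOL-Algebra.QuotRing"
    "Jordan_Normal_Form.Determinant"
begin

text \<open>
  The class \<^class>\<open>comm_ring_1\<close> contains the axiom \<open>0 \<noteq> 1\<close>.  Commutative rings are rendered here by
  the sort \<open>{comm_ring, comm_monoid_mult}\<close>, so that the zero ring (and with it rank 0) is allowed;
  every \<^class>\<open>comm_ring_1\<close> type has this sort.
\<close>

section \<open>Commutative algebras, bases and coordinates\<close>

text \<open>An algebra is given by its structure map \<open>\<rho>\<close>: the scalar \<open>a\<close> acts on \<open>x\<close> as \<open>\<rho> a * x\<close>.\<close>

locale comm_algebra = comm_monoid_add_hom \<rho> + comm_monoid_mult_hom \<rho>
  for \<rho> :: "'a::{comm_ring,comm_monoid_mult} \<Rightarrow> 'b::{comm_ring,comm_monoid_mult}"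

definition lin_comb ::
  "('a \<Rightarrow> 'b) \<Rightarrow> nat \<Rightarrow> (nat \<Rightarrow> 'b) \<Rightarrow> 'a vec \<Rightarrow> 'b::{comm_ring,comm_monoid_mult}" where
  "lin_comb \<rho> n e c = (\<Sum>i<n. \<rho> (c $ i) * e i)"

text \<open>Only the values \<open>e 0, \<dots>, e (n - 1)\<close> matter: indices run from \<open>0\<close>, as for matrices.\<close>

definition is_basis ::
  "('a \<Rightarrow> 'b) \<Rightarrow> nat \<Rightarrow> (nat \<Rightarrow> 'b::{comm_ring,comm_monoid_mult}) \<Rightarrow> bool" where
  "is_basis \<rho> n e \<longleftrightarrow> (\<forall>x. \<exists>!c. c \<in> carrier_vec n \<and> x = lin_comb \<rho> n e c)"

definition coords ::
  "('a \<Rightarrow> 'b) \<Rightarrow> nat \<Rightarrow> (nat \<Rightarrow> 'b::{comm_ring,comm_monoid_mult}) \<Rightarrow> 'b \<Rightarrow> 'a vec" where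
  "coords \<rho> n e x = (THE c. c \<in> carrier_vec n \<and> x = lin_comb \<rho> n e c)"

definition mult_matrix ::
  "('a \<Rightarrow> 'b) \<Rightarrow> nat \<Rightarrow> (nat \<Rightarrow> 'b::{comm_ring,comm_monoid_mult}) \<Rightarrow> 'b \<Rightarrow> 'a mat" where
  "mult_matrix \<rho> n e b = mat n n (\<lambda>(i, j). coords \<rho> n e (b * e j) $ i)"

section \<open>Trace, norm and discriminant\<close>

definition mat_trace :: "'a::comm_monoid_add mat \<Rightarrow> 'a" where
  "mat_trace M = (\<Sum>i<dim_row M. M $$ (i, i))"

text \<open>
  The Leibniz formula, with the sign written so that \<open>0 \<noteq> 1\<close> is not needed.
  On \<^class>\<open>comm_ring_1\<close> it is \<^const>\<open>Determinant.det\<close>, see \<open>mat_det_eq_det\<close> below.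
\<close>

definition mat_det :: "'a::{comm_ring,comm_monoid_mult} mat \<Rightarrow> 'a" where
  "mat_det M = (\<Sum>p | p permutes {0..<dim_row M}.
     let t = (\<Prod>i = 0..<dim_row M. M $$ (i, p i)) in if evenperm p then t else - t)"

lemma mat_det_eq_det:
  fixes M :: "'a::comm_ring_1 mat"
  assumes "dim_row M = dim_col M"
  shows "mat_det M = Determinant.det M"
  using assms unfolding mat_det_def Determinant.det_def
  by (auto intro!: sum.cong simp: sign_def Let_def)

text \<open>
  Trace and norm belong to the algebra, not to a given basis: they are computed in an arbitrarily
  chosen basis of \<open>n\<close> elements.
\<close>

definition alg_trace ::
  "('a::comm_monoid_add \<Rightarrow> 'b) \<Rightarrow> nat \<Rightarrow> 'b::{comm_ring,comm_monoid_mult} \<Rightarrow> 'a" where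
  "alg_trace \<rho> n b = mat_trace (mult_matrix \<rho> n (SOME e. is_basis \<rho> n e) b)"

definition alg_norm ::
  "('a::{comm_ring,comm_monoid_mult} \<Rightarrow> 'b) \<Rightarrow> nat \<Rightarrow> 'b::{comm_ring,comm_monoid_mult} \<Rightarrow> 'a" where
  "alg_norm \<rho> n b = mat_det (mult_matrix \<rho> n (SOME e. is_basis \<rho> n e) b)"

definition trace_matrix ::
  "('a::comm_monoid_add \<Rightarrow> 'b) \<Rightarrow> nat \<Rightarrow> (nat \<Rightarrow> 'b::{comm_ring,comm_monoid_mult}) \<Rightarrow> 'a mat" where
  "trace_matrix \<rho> n e = mat n n (\<lambda>(i, j). alg_trace \<rho> n (e i * e j))"

definition disc ::
  "('a::{comm_ring,comm_monoid_mult} \<Rightarrow> 'b) \<Rightarrow> nat \<Rightarrow> (nat \<Rightarrow> 'b::{comm_ring,comm_monoid_mult}) \<Rightarrow> 'a" where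
  "disc \<rho> n e = mat_det (trace_matrix \<rho> n e)"

section \<open>The ring \<open>B \<otimes>\<^sub>A B\<close>\<close>

text \<open>
  The free \<open>A\<close>-module on \<open>B \<times> B\<close> is the type \<open>'b tens \<Rightarrow>\<^sub>0 'a\<close>.  The product of
  \<^typ>\<open>_ \<Rightarrow>\<^sub>0 _\<close> is the convolution along the \<^emph>\<open>additive\<close> monoid of keys; the componentwise product
  of \<open>B \<times> B\<close> is therefore written additively on \<open>'b tens\<close>.
\<close>

datatype 'b tens = Tens (lft: 'b) (rgt: 'b)

instantiation tens :: (comm_monoid_mult) comm_monoid_add
begin
definition zero_tens :: "'a tens" where "zero_tens = Tens 1 1"
definition plus_tens :: "'a tens \<Rightarrow> 'a tens \<Rightarrow> 'a tens" where
  "plus_tens p q = Tens (lft p * lft q) (rgt p * rgt q)"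
instance
  by standard (auto simp: zero_tens_def plus_tens_def ac_simps)
end

abbreviation gen :: "'b \<Rightarrow> 'b \<Rightarrow> 'a \<Rightarrow> 'b tens \<Rightarrow>\<^sub>0 'a::zero" where
  "gen x y a \<equiv> Poly_Mapping.single (Tens x y) a"

definition free_ring ::
  "('b::comm_monoid_mult tens \<Rightarrow>\<^sub>0 'a::{comm_ring,comm_monoid_mult}) ring" where
  "free_ring = \<lparr>carrier = UNIV, monoid.mult = (*), one = gen 1 1 1, zero = 0, add = (+)\<rparr>"

definition type_ring :: "'b::{comm_ring,comm_monoid_mult} ring" where
  "type_ring = \<lparr>carrier = UNIV, monoid.mult = (*), one = 1, zero = 0, add = (+)\<rparr>"

text \<open>The \<open>A\<close>-submodule generated by the bilinearity relations.\<close>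

inductive_set tensor_rels ::
    "('a \<Rightarrow> 'b) \<Rightarrow> ('b::{comm_ring,comm_monoid_mult} tens \<Rightarrow>\<^sub>0 'a::{comm_ring,comm_monoid_mult}) set"
  for \<rho> where
  add_left: "gen (x + x') y 1 - gen x y 1 - gen x' y 1 \<in> tensor_rels \<rho>"
| add_right: "gen x (y + y') 1 - gen x y 1 - gen x y' 1 \<in> tensor_rels \<rho>"
| scale_left: "gen (\<rho> a * x) y 1 - gen x y a \<in> tensor_rels \<rho>"
| scale_right: "gen x (\<rho> a * y) 1 - gen x y a \<in> tensor_rels \<rho>"
| zero: "0 \<in> tensor_rels \<rho>"
| add: "f \<in> tensor_rels \<rho> \<Longrightarrow> g \<in> tensor_rels \<rho> \<Longrightarrow> f + g \<in> tensor_rels \<rho>"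
| smult: "f \<in> tensor_rels \<rho> \<Longrightarrow> Poly_Mapping.map ((*) a) f \<in> tensor_rels \<rho>"

definition tensor_ring ::
  "('a \<Rightarrow> 'b) \<Rightarrow>
   ('b::{comm_ring,comm_monoid_mult} tens \<Rightarrow>\<^sub>0 'a::{comm_ring,comm_monoid_mult}) set ring" where
  "tensor_ring \<rho> = free_ring Quot tensor_rels \<rho>"

definition pure_tensor ::
  "('a \<Rightarrow> 'b) \<Rightarrow> 'b \<Rightarrow> 'b \<Rightarrow>
   ('b::{comm_ring,comm_monoid_mult} tens \<Rightarrow>\<^sub>0 'a::{comm_ring,comm_monoid_mult}) set" where
  "pure_tensor \<rho> x y = tensor_rels \<rho> +>\<^bsub>free_ring\<^esub> gen x y 1"

text \<open>The map \<open>\<mu>\<close> is induced by the linear extension of \<open>(x, y) \<mapsto> x * y\<close>.\<close>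

definition free_mu ::
  "('a \<Rightarrow> 'b) \<Rightarrow> ('b tens \<Rightarrow>\<^sub>0 'a::zero) \<Rightarrow> 'b::{comm_ring,comm_monoid_mult}" where
  "free_mu \<rho> f =
     (\<Sum>k\<in>Poly_Mapping.keys f. \<rho> (Poly_Mapping.lookup f k) * (lft k * rgt k))"

definition mu ::
  "('a \<Rightarrow> 'b) \<Rightarrow> ('b tens \<Rightarrow>\<^sub>0 'a::zero) set \<Rightarrow> 'b::{comm_ring,comm_monoid_mult}" where
  "mu \<rho> X = the_elem (free_mu \<rho> ` X)"

definition diag_ideal ::
  "('a \<Rightarrow> 'b) \<Rightarrow>
   ('b::{comm_ring,comm_monoid_mult} tens \<Rightarrow>\<^sub>0 'a::{comm_ring,comm_monoid_mult}) set set" where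
  "diag_ideal \<rho> = a_kernel (tensor_ring \<rho>) type_ring (mu \<rho>)"

definition annihilator :: "('c, 'm) ring_scheme \<Rightarrow> 'c set \<Rightarrow> 'c set" where
  "annihilator R I = {d \<in> carrier R. \<forall>x\<in>I. d \<otimes>\<^bsub>R\<^esub> x = \<zero>\<^bsub>R\<^esub>}"

section \<open>The tensor product is a commutative ring and \<open>\<mu>\<close> a ring homomorphism\<close>

lemma poly_mapping_single_induct [case_names single sum]:
  fixes f :: "'k \<Rightarrow>\<^sub>0 'c::comm_monoid_add"
  assumes single: "\<And>k v. P (Poly_Mapping.single k v)"
    and sum: "\<And>f g. P f \<Longrightarrow> P g \<Longrightarrow> P (f + g)"
  shows "P f"
proof -
  have zero: "P 0" using single[of _ 0] by simp
  have "P (\<Sum>k\<in>K. Poly_Mapping.single k (Poly_Mapping.lookup f k))" if "finite K" for K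
    using that by induction (auto intro: assms zero)
  moreover have "(\<Sum>k\<in>Poly_Mapping.keys f. Poly_Mapping.single k (Poly_Mapping.lookup f k)) = f"
    by (rule poly_mapping_eqI)
       (auto simp: lookup_sum lookup_single when_def sum.delta in_keys_iff)
  ultimately show ?thesis by (metis finite_keys)
qed

lemma cring_free_ring:
  "cring (free_ring :: ('b::comm_monoid_mult tens \<Rightarrow>\<^sub>0 'a::{comm_ring,comm_monoid_mult}) ring)"
proof (rule cringI)
  let ?F = "free_ring :: ('b tens \<Rightarrow>\<^sub>0 'a) ring"
  have one: "gen 1 1 1 * f = f" for f :: "'b tens \<Rightarrow>\<^sub>0 'a"
  proof (induction f rule: poly_mapping_single_induct)
    case (single k v)
    show ?case by (simp add: mult_single zero_tens_def[symmetric])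
  next
    case (sum f g)
    then show ?case by (simp add: distrib_left)
  qed
  have one': "f * gen 1 1 1 = f" for f :: "'b tens \<Rightarrow>\<^sub>0 'a"
    using one[of f] by (simp add: mult.commute)
  show "abelian_group ?F"
  proof (rule abelian_groupI)
    fix x assume "x \<in> carrier ?F"
    show "\<exists>y\<in>carrier ?F. y \<oplus>\<^bsub>?F\<^esub> x = \<zero>\<^bsub>?F\<^esub>"
      by (rule bexI[of _ "- x"]) (auto simp: free_ring_def)
  qed (auto simp: free_ring_def algebra_simps)
  show "comm_monoid ?F"
    by (rule comm_monoidI) (auto simp: free_ring_def one one' ac_simps)
qed (auto simp: free_ring_def algebra_simps)

lemma cring_type_ring: "cring (type_ring :: 'b::{comm_ring,comm_monoid_mult} ring)"
proof (rule cringI)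
  let ?F = "type_ring :: 'b ring"
  show "abelian_group ?F"
  proof (rule abelian_groupI)
    fix x assume "x \<in> carrier ?F"
    show "\<exists>y\<in>carrier ?F. y \<oplus>\<^bsub>?F\<^esub> x = \<zero>\<^bsub>?F\<^esub>"
      by (rule bexI[of _ "- x"]) (auto simp: type_ring_def)
  qed (auto simp: type_ring_def algebra_simps)
  show "comm_monoid ?F"
    by (rule comm_monoidI) (auto simp: type_ring_def algebra_simps)
qed (auto simp: type_ring_def algebra_simps)

lemma map_times_eq: "Poly_Mapping.map ((*) a) f = gen 1 1 a * f"
  for f :: "'b::comm_monoid_mult tens \<Rightarrow>\<^sub>0 'a::{comm_ring,comm_monoid_mult}"
proof -
  have map_add: "Poly_Mapping.map ((*) a) (f + g) =
      Poly_Mapping.map ((*) a) f + Poly_Mapping.map ((*) a) g"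
    for f g :: "'b tens \<Rightarrow>\<^sub>0 'a"
    by (rule poly_mapping_eqI)
       (auto simp: Poly_Mapping.map.rep_eq lookup_add when_def distrib_left[symmetric])
  show ?thesis
  proof (induction f rule: poly_mapping_single_induct)
    case (single k v)
    show ?case
      by (rule poly_mapping_eqI)
         (auto simp: Poly_Mapping.map.rep_eq mult_single zero_tens_def[symmetric]
            lookup_single when_def)
  next
    case (sum f g)
    then show ?case by (simp add: map_add distrib_left)
  qed
qed

context comm_algebra
begin

lemma tensor_rels_uminus: "f \<in> tensor_rels \<rho> \<Longrightarrow> - f \<in> tensor_rels \<rho>"
proof -
  assume f: "f \<in> tensor_rels \<rho>"
  have "(gen 1 1 (- 1) :: 'b tens \<Rightarrow>\<^sub>0 'a) = - gen 1 1 1"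
    by (simp add: single_uminus)
  then have "gen 1 1 (- 1) * f = - (gen 1 1 1 * f)" by simp
  also have "gen 1 1 1 * f = f"
    using monoid.l_one[OF comm_monoid.axioms(1)[OF cring.axioms(2)[OF cring_free_ring]], of f]
    by (simp add: free_ring_def)
  finally show ?thesis using tensor_rels.smult[OF f, of "- 1"] by (simp add: map_times_eq)
qed

lemma tensor_rels_single_mult:
  assumes "f \<in> tensor_rels \<rho>"
  shows "gen u v a * f \<in> tensor_rels \<rho>"
proof -
  have eq: "gen u v a * f = gen 1 1 a * (gen u v 1 * f)" for f
    by (simp add: mult.assoc[symmetric] mult_single plus_tens_def)
  have "gen u v 1 * f \<in> tensor_rels \<rho>"
    using assms
  proof induction
    case (add_left x x' y)
    then show ?case
      using tensor_rels.add_left[of "u * x" "u * x'" "v * y" \<rho>]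
      by (simp add: right_diff_distrib mult_single plus_tens_def distrib_left)
  next
    case (add_right x y y')
    then show ?case
      using tensor_rels.add_right[of "u * x" "v * y" "v * y'" \<rho>]
      by (simp add: right_diff_distrib mult_single plus_tens_def distrib_left)
  next
    case (scale_left b x y)
    then show ?case
      using tensor_rels.scale_left[of \<rho> b "u * x" "v * y"]
      by (simp add: right_diff_distrib mult_single plus_tens_def mult.left_commute)
  next
    case (scale_right x b y)
    then show ?case
      using tensor_rels.scale_right[of "u * x" \<rho> b "v * y"]
      by (simp add: right_diff_distrib mult_single plus_tens_def mult.left_commute)
  next
    case zero
    then show ?case by (simp add: tensor_rels.zero)
  next
    case (add f g)
    then show ?case by (simp add: distrib_left tensor_rels.add)
  next
    case (smult f b)
    then show ?case
      using tensor_rels.smult[of "gen u v 1 * f" \<rho> b]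
      by (simp add: map_times_eq mult.left_commute)
  qed
  then show ?thesis
    by (subst eq) (simp only: map_times_eq[symmetric] tensor_rels.smult)
qed

lemma tensor_rels_mult:
  assumes "f \<in> tensor_rels \<rho>"
  shows "g * f \<in> tensor_rels \<rho>"
proof (induction g rule: poly_mapping_single_induct)
  case (single k v)
  then show ?case using tensor_rels_single_mult[OF assms] by (cases k) auto
next
  case (sum f g)
  then show ?case by (simp add: distrib_right tensor_rels.add)
qed

lemma ideal_tensor_rels: "ideal (tensor_rels \<rho>) free_ring"
proof (rule idealI)
  show "ring (free_ring :: ('b tens \<Rightarrow>\<^sub>0 'a) ring)"
    using cring_free_ring cring.axioms(1) by blast
  show "subgroup (tensor_rels \<rho>) (add_monoid free_ring)"
  proof (rule group.subgroupI)
    show "group (add_monoid (free_ring :: ('b tens \<Rightarrow>\<^sub>0 'a) ring))"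
      using abelian_group.a_group cring_free_ring cring.axioms(1) ring.axioms(1) by blast
    fix f assume f: "f \<in> tensor_rels \<rho>"
    have "inv\<^bsub>add_monoid free_ring\<^esub> f = - f"
      by (rule group.inv_equality
          [OF abelian_group.a_group
              [OF ring.axioms(1)[OF cring.axioms(1)[OF cring_free_ring]]]])
         (auto simp: free_ring_def)
    then show "inv\<^bsub>add_monoid free_ring\<^esub> f \<in> tensor_rels \<rho>"
      using tensor_rels_uminus[OF f] by simp
  qed (use tensor_rels.zero[of \<rho>] in \<open>auto simp: free_ring_def intro: tensor_rels.add\<close>)
next
  fix f g assume f: "f \<in> tensor_rels \<rho>"
  show "g \<otimes>\<^bsub>free_ring\<^esub> f \<in> tensor_rels \<rho>"
    using tensor_rels_mult[OF f] by (simp add: free_ring_def)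
  show "f \<otimes>\<^bsub>free_ring\<^esub> g \<in> tensor_rels \<rho>"
    using tensor_rels_mult[OF f, of g] by (simp add: free_ring_def mult.commute)
qed

theorem cring_tensor_ring: "cring (tensor_ring \<rho>)"
  unfolding tensor_ring_def
  by (rule ideal.quotient_is_cring[OF ideal_tensor_rels cring_free_ring])

lemma free_mu_single [simp]: "free_mu \<rho> (gen x y a) = \<rho> a * (x * y)"
  by (simp add: free_mu_def)

lemma free_mu_superset:
  assumes "finite K" "Poly_Mapping.keys f \<subseteq> K"
  shows "free_mu \<rho> f = (\<Sum>k\<in>K. \<rho> (Poly_Mapping.lookup f k) * (lft k * rgt k))"
  unfolding free_mu_def
  by (rule sum.mono_neutral_left) (use assms in \<open>auto simp: in_keys_iff\<close>)

lemma free_mu_add: "free_mu \<rho> (f + g) = free_mu \<rho> f + free_mu \<rho> g"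
proof -
  let ?K = "Poly_Mapping.keys f \<union> Poly_Mapping.keys g"
  have "Poly_Mapping.keys (f + g) \<subseteq> ?K" by (rule Poly_Mapping.keys_add)
  then show ?thesis
    by (simp add: free_mu_superset[of ?K] lookup_add hom_add distrib_right sum.distrib)
qed

lemma free_mu_mult: "free_mu \<rho> (f * g) = free_mu \<rho> f * free_mu \<rho> g"
proof (induction f rule: poly_mapping_single_induct)
  case (single k v)
  show ?case
  proof (induction g rule: poly_mapping_single_induct)
    case (single k' v')
    then show ?case
      by (cases k; cases k') (simp add: mult_single plus_tens_def hom_mult ac_simps)
  next
    case (sum f g)
    then show ?case by (simp add: distrib_left free_mu_add)
  qed
next
  case (sum f g)
  then show ?case by (simp add: distrib_right free_mu_add)
qed

lemma free_mu_diff: "free_mu \<rho> (f - g) = free_mu \<rho> f - free_mu \<rho> g"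
  using free_mu_add[of "f - g" g] by (simp add: algebra_simps)

lemma free_mu_tensor_rels: "f \<in> tensor_rels \<rho> \<Longrightarrow> free_mu \<rho> f = 0"
proof (induction rule: tensor_rels.induct)
  case zero
  show ?case by (simp add: free_mu_def)
qed (simp_all add: free_mu_diff free_mu_add map_times_eq free_mu_mult algebra_simps)

lemma mu_coset: "mu \<rho> (tensor_rels \<rho> +>\<^bsub>free_ring\<^esub> f) = free_mu \<rho> f"
proof -
  have "free_mu \<rho> ` (tensor_rels \<rho> +>\<^bsub>free_ring\<^esub> f) = {free_mu \<rho> f}"
    using tensor_rels.zero
    by (force simp: a_r_coset_def r_coset_def free_ring_def free_mu_add free_mu_tensor_rels)
  then show ?thesis by (simp add: mu_def)
qed

theorem mu_pure_tensor: "mu \<rho> (pure_tensor \<rho> x y) = x * y"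
  by (simp add: pure_tensor_def mu_coset)

theorem mu_ring_hom: "mu \<rho> \<in> Ring.ring_hom (tensor_ring \<rho>) type_ring"
proof (rule ring_hom_memI)
  interpret I: ideal "tensor_rels \<rho>" free_ring by (rule ideal_tensor_rels)
  have carr: "\<exists>f. X = tensor_rels \<rho> +>\<^bsub>free_ring\<^esub> f" if "X \<in> carrier (tensor_ring \<rho>)" for X
    using that by (auto simp: tensor_ring_def FactRing_def A_RCOSETS_def')
  fix X Y assume "X \<in> carrier (tensor_ring \<rho>)" "Y \<in> carrier (tensor_ring \<rho>)"
  then obtain f g where XY: "X = tensor_rels \<rho> +>\<^bsub>free_ring\<^esub> f" "Y = tensor_rels \<rho> +>\<^bsub>free_ring\<^esub> g"
    using carr by blast
  have in_c: "h \<in> carrier free_ring" for h :: "'b tens \<Rightarrow>\<^sub>0 'a" by (simp add: free_ring_def)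
  have "X \<otimes>\<^bsub>tensor_ring \<rho>\<^esub> Y = tensor_rels \<rho> +>\<^bsub>free_ring\<^esub> (f * g)"
    using I.rcoset_mult_add[OF in_c in_c, of f g]
    by (simp add: XY tensor_ring_def FactRing_def) (simp add: free_ring_def)
  then show "mu \<rho> (X \<otimes>\<^bsub>tensor_ring \<rho>\<^esub> Y) = mu \<rho> X \<otimes>\<^bsub>type_ring\<^esub> mu \<rho> Y"
    by (simp add: XY mu_coset free_mu_mult type_ring_def)
  have "X \<oplus>\<^bsub>tensor_ring \<rho>\<^esub> Y = tensor_rels \<rho> +>\<^bsub>free_ring\<^esub> (f + g)"
    using I.a_rcos_sum[OF in_c in_c, of f g]
    by (simp add: XY tensor_ring_def FactRing_def) (simp add: free_ring_def)
  then show "mu \<rho> (X \<oplus>\<^bsub>tensor_ring \<rho>\<^esub> Y) = mu \<rho> X \<oplus>\<^bsub>type_ring\<^esub> mu \<rho> Y"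
    by (simp add: XY mu_coset free_mu_add type_ring_def)
next
  have "\<one>\<^bsub>tensor_ring \<rho>\<^esub> = tensor_rels \<rho> +>\<^bsub>free_ring\<^esub> gen 1 1 1"
    by (simp add: tensor_ring_def FactRing_def) (simp add: free_ring_def)
  then show "mu \<rho> \<one>\<^bsub>tensor_ring \<rho>\<^esub> = \<one>\<^bsub>type_ring\<^esub>"
    by (simp add: mu_coset type_ring_def)
qed (simp add: type_ring_def)

end

end

theory Submission
  imports Defs
begin

text \<open>
  For \<open>\<delta> = \<Sum>\<^sub>i u\<^sub>i \<otimes> \<epsilon>\<^sub>i\<close> in \<open>Ann(J)\<close> one has \<open>\<delta> (y \<otimes> 1) = \<delta> (1 \<otimes> y)\<close> for all \<open>y\<close>.  Let \<open>\<epsilon>\<^sub>k\<^sup>*\<close> be the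
  coordinate forms.  Applying \<open>\<epsilon>\<^sub>k\<^sup>* \<otimes> id\<close> with \<open>y = x \<epsilon>\<^sub>k\<close> and summing over \<open>k\<close> gives
  \<open>\<Sum>\<^sub>i Tr(u\<^sub>i x) \<epsilon>\<^sub>i = \<Sum>\<^sub>i \<Sum>\<^sub>k \<epsilon>\<^sub>k\<^sup>*(u\<^sub>i) \<epsilon>\<^sub>k x \<epsilon>\<^sub>i = x \<mu>(\<delta>)\<close>, which for \<open>x = \<epsilon>\<^sub>j\<close> is the \<open>j\<close>-th column
  of the first equality.  The rest is linearity of the trace and multiplicativity of the determinant.
\<close>

section \<open>Determinants over possibly trivial rings\<close>

text \<open>
  Every commutative ring, the zero ring included, is a quotient of its product with the integers, and
  that product satisfies \<open>0 \<noteq> 1\<close>.  This transports \<open>det_mult\<close> to \<^const>\<open>mat_det\<close>.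
\<close>

datatype 'a int_prod = IntProd (int_part: int) (ring_part: 'a)

instantiation int_prod :: ("{comm_ring,comm_monoid_mult}") comm_ring_1
begin
definition "0 = IntProd 0 0"
definition "1 = IntProd 1 1"
definition "x + y = IntProd (int_part x + int_part y) (ring_part x + ring_part y)"
definition "x - y = IntProd (int_part x - int_part y) (ring_part x - ring_part y)"
definition "- x = IntProd (- int_part x) (- ring_part x)"
definition "x * y = IntProd (int_part x * int_part y) (ring_part x * ring_part y)"
instance
  by standard
    (auto simp: zero_int_prod_def one_int_prod_def plus_int_prod_def minus_int_prod_def
      uminus_int_prod_def times_int_prod_def algebra_simps)
end

lemma ring_part_simps [simp]:
  "ring_part 0 = 0" "ring_part 1 = 1"
  "ring_part (x + y) = ring_part x + ring_part y"
  "ring_part (- x) = - ring_part x"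
  "ring_part (x * y) = ring_part x * ring_part y"
  by (simp_all add: zero_int_prod_def one_int_prod_def plus_int_prod_def
      uminus_int_prod_def times_int_prod_def)

lemma ring_part_sum: "ring_part (\<Sum>i\<in>I. f i) = (\<Sum>i\<in>I. ring_part (f i))"
  by (induction I rule: infinite_finite_induct) auto

lemma ring_part_prod: "ring_part (\<Prod>i\<in>I. f i) = (\<Prod>i\<in>I. ring_part (f i))"
  by (induction I rule: infinite_finite_induct) auto

text \<open>The Leibniz formula is built from sums, products and signs, all of which
  \<open>ring_part\<close> preserves. Squareness keeps every index \<open>(i, p i)\<close> inside
  the matrix, where \<open>map_mat\<close> acts.\<close>

lemma ring_part_mat_det:
  assumes "M \<in> carrier_mat n n"
  shows "ring_part (mat_det M) = mat_det (map_mat ring_part M)"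
  using assms unfolding mat_det_def ring_part_sum
  by (auto simp: ring_part_prod Let_def permutes_in_image intro!: sum.cong prod.cong)

lemma mat_det_mult:
  fixes A B :: "'a::{comm_ring,comm_monoid_mult} mat"
  assumes A: "A \<in> carrier_mat n n" and B: "B \<in> carrier_mat n n"
  shows "mat_det (A * B) = mat_det A * mat_det B"
proof -
  \<comment> \<open>The lift only has to be a section of \<open>ring_part\<close>. The determinants
    are multiplied in the product ring, and the projection carries the identity back.\<close>
  let ?L = "map_mat (IntProd 0) :: 'a mat \<Rightarrow> 'a int_prod mat"
  have L: "map_mat ring_part (?L M) = M" for M
    by (rule eq_matI) auto
  have AB: "map_mat ring_part (?L A * ?L B) = A * B"
    using A B by (intro eq_matI) (auto simp: scalar_prod_def ring_part_sum)
  have lA: "?L A \<in> carrier_mat n n" and lB: "?L B \<in> carrier_mat n n"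
    using A B by auto
  have "mat_det (?L A * ?L B) = mat_det (?L A) * mat_det (?L B)"
    using det_mult[OF lA lB] A B by (simp add: mat_det_eq_det)
  from arg_cong[OF this, of ring_part] show ?thesis
    using lA lB by (simp add: ring_part_mat_det[of _ n] L AB)
qed

section \<open>Traces of products\<close>

lemma mat_trace_mult_commute:
  fixes A B :: "'a::comm_ring mat"
  assumes "A \<in> carrier_mat n m" "B \<in> carrier_mat m n"
  shows "mat_trace (A * B) = mat_trace (B * A)"
proof -
  have "mat_trace (A * B) = (\<Sum>i<n. \<Sum>j<m. A $$ (i, j) * B $$ (j, i))"
    using assms by (auto simp: mat_trace_def scalar_prod_def lessThan_atLeast0 intro!: sum.cong)
  also have "\<dots> = (\<Sum>j<m. \<Sum>i<n. B $$ (j, i) * A $$ (i, j))"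
    by (subst sum.swap) (simp add: mult.commute)
  also have "\<dots> = mat_trace (B * A)"
    using assms by (auto simp: mat_trace_def scalar_prod_def lessThan_atLeast0 intro!: sum.cong)
  finally show ?thesis .
qed

section \<open>Coordinates, trace and norm\<close>

text \<open>
  The matrix of multiplication by \<open>b\<close> with respect to the basis \<open>f\<close> of the source and the basis \<open>e\<close>
  of the target; with \<open>b = 1\<close> it is a change of basis.
\<close>

definition basis_matrix ::
  "('a \<Rightarrow> 'b) \<Rightarrow> nat \<Rightarrow> (nat \<Rightarrow> 'b) \<Rightarrow> (nat \<Rightarrow> 'b::{comm_ring,comm_monoid_mult}) \<Rightarrow> 'b \<Rightarrow> 'a mat"
  where "basis_matrix \<rho> n e f b = mat n n (\<lambda>(i, j). coords \<rho> n e (b * f j) $ i)"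

lemma basis_matrix_carrier [simp]: "basis_matrix \<rho> n e f b \<in> carrier_mat n n"
  by (simp add: basis_matrix_def)

lemma mult_matrix_eq_basis_matrix: "mult_matrix \<rho> n e b = basis_matrix \<rho> n e e b"
  by (simp add: mult_matrix_def basis_matrix_def)

context comm_algebra
begin

lemma hom_sum: "\<rho> (\<Sum>i\<in>I. f i) = (\<Sum>i\<in>I. \<rho> (f i))"
  by (induction I rule: infinite_finite_induct) (auto simp: hom_add)

lemma coords_props:
  assumes "is_basis \<rho> n e"
  shows coords_carrier: "coords \<rho> n e x \<in> carrier_vec n"
    and lin_comb_coords: "lin_comb \<rho> n e (coords \<rho> n e x) = x"
proof -
  have "\<exists>!c. c \<in> carrier_vec n \<and> x = lin_comb \<rho> n e c"
    using assms by (simp add: is_basis_def)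
  from theI'[OF this] show "coords \<rho> n e x \<in> carrier_vec n"
    "lin_comb \<rho> n e (coords \<rho> n e x) = x"
    by (simp_all add: coords_def)
qed

lemma coords_expand:
  "is_basis \<rho> n e \<Longrightarrow> (\<Sum>i<n. \<rho> (coords \<rho> n e x $ i) * e i) = x"
  using lin_comb_coords by (simp add: lin_comb_def)

lemma coords_unique:
  assumes "is_basis \<rho> n e" "x = (\<Sum>i<n. \<rho> (c i) * e i)" "i < n"
  shows "coords \<rho> n e x $ i = c i"
proof -
  have "\<exists>!c. c \<in> carrier_vec n \<and> x = lin_comb \<rho> n e c"
    using assms(1) by (simp add: is_basis_def)
  moreover have "x = lin_comb \<rho> n e (vec n c)"
    using assms(2) by (simp add: lin_comb_def)
  ultimately have "coords \<rho> n e x = vec n c"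
    using coords_carrier[OF assms(1), of x] lin_comb_coords[OF assms(1), of x] vec_carrier by metis
  then show ?thesis using assms(3) by simp
qed

lemma coords_add:
  assumes "is_basis \<rho> n e" "i < n"
  shows "coords \<rho> n e (x + y) $ i = coords \<rho> n e x $ i + coords \<rho> n e y $ i"
proof (rule coords_unique[OF assms(1) _ assms(2)])
  show "x + y = (\<Sum>i<n. \<rho> (coords \<rho> n e x $ i + coords \<rho> n e y $ i) * e i)"
    by (simp add: hom_add distrib_right sum.distrib coords_expand[OF assms(1)])
qed

lemma coords_scale:
  assumes "is_basis \<rho> n e" "i < n"
  shows "coords \<rho> n e (\<rho> a * x) $ i = a * coords \<rho> n e x $ i"
proof (rule coords_unique[OF assms(1) _ assms(2)])
  show "\<rho> a * x = (\<Sum>i<n. \<rho> (a * coords \<rho> n e x $ i) * e i)"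
    by (simp add: hom_mult mult.assoc sum_distrib_left[symmetric] coords_expand[OF assms(1)])
qed

lemma coords_zero:
  assumes "is_basis \<rho> n e" "i < n"
  shows "coords \<rho> n e 0 $ i = 0"
  by (rule coords_unique[OF assms(1) _ assms(2)]) simp

lemma coords_sum:
  assumes "is_basis \<rho> n e" "i < n"
  shows "coords \<rho> n e (\<Sum>k\<in>K. f k) $ i = (\<Sum>k\<in>K. coords \<rho> n e (f k) $ i)"
  by (induction K rule: infinite_finite_induct)
    (auto simp: coords_add[OF assms] coords_zero[OF assms])

text \<open>Matrix form of composing two multiplication maps, \<open>b'\<close> first and then
  \<open>b\<close>; the intermediate basis \<open>f\<close> drops out. Taking one factor to be 1
  gives base change without inverting a matrix.\<close>

lemma basis_matrix_mult:
  assumes e: "is_basis \<rho> n e" and f: "is_basis \<rho> n f"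
  shows "basis_matrix \<rho> n e f b * basis_matrix \<rho> n f g b' = basis_matrix \<rho> n e g (b * b')"
proof (rule eq_matI)
  fix i j
  assume "i < dim_row (basis_matrix \<rho> n e g (b * b'))" "j < dim_col (basis_matrix \<rho> n e g (b * b'))"
  then have i: "i < n" and j: "j < n" by (simp_all add: basis_matrix_def)
  let ?c = "\<lambda>k. coords \<rho> n f (b' * g j) $ k"
  have "b * b' * g j = b * (\<Sum>k<n. \<rho> (?c k) * f k)"
    by (simp add: coords_expand[OF f] mult.assoc)
  also have "\<dots> = (\<Sum>k<n. \<rho> (?c k) * (b * f k))"
    by (simp add: sum_distrib_left mult.left_commute)
  finally have "coords \<rho> n e (b * b' * g j) $ i = (\<Sum>k<n. ?c k * coords \<rho> n e (b * f k) $ i)"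
    by (simp add: coords_sum[OF e i] coords_scale[OF e i])
  then show "(basis_matrix \<rho> n e f b * basis_matrix \<rho> n f g b') $$ (i, j) =
      basis_matrix \<rho> n e g (b * b') $$ (i, j)"
    using i j by (simp add: basis_matrix_def scalar_prod_def lessThan_atLeast0 mult.commute)
qed (simp_all add: basis_matrix_def)

text \<open>With \<open>X = basis_matrix \<rho> n e f b\<close> and
  \<open>Y = basis_matrix \<rho> n f e 1\<close>, the two sides are the traces of
  \<open>X * Y\<close> and \<open>Y * X\<close>.\<close>

lemma mat_trace_mult_matrix_cong:
  assumes e: "is_basis \<rho> n e" and f: "is_basis \<rho> n f"
  shows "mat_trace (mult_matrix \<rho> n e b) = mat_trace (mult_matrix \<rho> n f b)"
  using basis_matrix_mult[OF e f, of b e 1] basis_matrix_mult[OF f e, of 1 f b]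
    mat_trace_mult_commute[of "basis_matrix \<rho> n e f b" n n "basis_matrix \<rho> n f e 1"]
  by (simp add: mult_matrix_eq_basis_matrix)

text \<open>The same two factors in both orders; their determinants commute.\<close>

lemma mat_det_mult_matrix_cong:
  assumes e: "is_basis \<rho> n e" and f: "is_basis \<rho> n f"
  shows "mat_det (mult_matrix \<rho> n e b) = mat_det (mult_matrix \<rho> n f b)"
  using basis_matrix_mult[OF e f, of b e 1] basis_matrix_mult[OF f e, of 1 f b]
    mat_det_mult[of "basis_matrix \<rho> n e f b" n "basis_matrix \<rho> n f e 1"]
    mat_det_mult[of "basis_matrix \<rho> n f e 1" n "basis_matrix \<rho> n e f b"]
  by (simp add: mult_matrix_eq_basis_matrix mult.commute)

text \<open>Since \<open>e\<close> witnesses that a basis exists, \<open>SOME\<close> does pick one,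
  and basis independence transfers the value to \<open>e\<close>. The trace is treated the same
  way.\<close>

lemma alg_norm_eq:
  assumes "is_basis \<rho> n e"
  shows "alg_norm \<rho> n b = mat_det (mult_matrix \<rho> n e b)"
  unfolding alg_norm_def
  by (rule mat_det_mult_matrix_cong[OF someI[of "is_basis \<rho> n", OF assms] assms])

lemma alg_trace_eq:
  assumes "is_basis \<rho> n e"
  shows "alg_trace \<rho> n b = (\<Sum>k<n. coords \<rho> n e (b * e k) $ k)"
proof -
  have "alg_trace \<rho> n b = mat_trace (mult_matrix \<rho> n e b)"
    unfolding alg_trace_def
    by (rule mat_trace_mult_matrix_cong[OF someI[of "is_basis \<rho> n", OF assms] assms])
  then show ?thesis by (simp add: mat_trace_def mult_matrix_def)
qed

lemma alg_trace_lin_comb: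
  assumes e: "is_basis \<rho> n e"
  shows "alg_trace \<rho> n (\<Sum>k\<in>K. \<rho> (c k) * x k) = (\<Sum>k\<in>K. c k * alg_trace \<rho> n (x k))"
proof -
  have "alg_trace \<rho> n (\<Sum>k\<in>K. \<rho> (c k) * x k) =
      (\<Sum>l<n. \<Sum>k\<in>K. c k * coords \<rho> n e (x k * e l) $ l)"
    by (simp add: alg_trace_eq[OF e] sum_distrib_right mult.assoc coords_sum[OF e] coords_scale[OF e])
  also have "\<dots> = (\<Sum>k\<in>K. c k * alg_trace \<rho> n (x k))"
    by (subst sum.swap) (simp add: alg_trace_eq[OF e] sum_distrib_left)
  finally show ?thesis .
qed

section \<open>Contraction of tensors with a linear form\<close>

text \<open>For a linear form \<open>\<phi>\<close>, \<open>contract \<phi>\<close> is \<open>\<phi> \<otimes> id\<close> on representatives.\<close>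

definition contract :: "('b \<Rightarrow> 'a) \<Rightarrow> ('b tens \<Rightarrow>\<^sub>0 'a) \<Rightarrow> 'b" where
  "contract \<phi> f =
     (\<Sum>k\<in>Poly_Mapping.keys f. \<rho> (Poly_Mapping.lookup f k) * (\<rho> (\<phi> (lft k)) * rgt k))"

lemma contract_single [simp]: "contract \<phi> (gen x y a) = \<rho> a * (\<rho> (\<phi> x) * y)"
  by (simp add: contract_def)

lemma contract_zero [simp]: "contract \<phi> 0 = 0"
  by (simp add: contract_def)

lemma contract_superset:
  assumes "finite K" "Poly_Mapping.keys f \<subseteq> K"
  shows "contract \<phi> f =
    (\<Sum>k\<in>K. \<rho> (Poly_Mapping.lookup f k) * (\<rho> (\<phi> (lft k)) * rgt k))"
  unfolding contract_def
  by (rule sum.mono_neutral_left) (use assms in \<open>auto simp: in_keys_iff\<close>)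

lemma contract_add: "contract \<phi> (f + g) = contract \<phi> f + contract \<phi> g"
proof -
  let ?K = "Poly_Mapping.keys f \<union> Poly_Mapping.keys g"
  have "Poly_Mapping.keys (f + g) \<subseteq> ?K" by (rule Poly_Mapping.keys_add)
  then show ?thesis
    by (simp add: contract_superset[of ?K] lookup_add hom_add distrib_right sum.distrib)
qed

lemma contract_diff: "contract \<phi> (f - g) = contract \<phi> f - contract \<phi> g"
  using contract_add[of \<phi> "f - g" g] by (simp add: algebra_simps)

lemma contract_sum: "contract \<phi> (\<Sum>i\<in>I. f i) = (\<Sum>i\<in>I. contract \<phi> (f i))"
  by (induction I rule: infinite_finite_induct) (auto simp: contract_add)

lemma contract_scale: "contract \<phi> (gen 1 1 a * f) = \<rho> a * contract \<phi> f"
proof (induction f rule: poly_mapping_single_induct)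
  case (single k v)
  show ?case
    by (cases k) (simp add: mult_single plus_tens_def hom_mult mult.assoc)
next
  case (sum f g)
  then show ?case by (simp add: distrib_left contract_add)
qed

text \<open>Linearity of \<phi> kills the relations in the left factor, and the ring laws of
  \<open>'b\<close> those in the right one. Hence contraction depends only on the tensor, not on its
  representative.\<close>

lemma contract_tensor_rels:
  assumes add: "\<And>x y. \<phi> (x + y) = \<phi> x + \<phi> y" and scale: "\<And>a x. \<phi> (\<rho> a * x) = a * \<phi> x"
    and "f \<in> tensor_rels \<rho>"
  shows "contract \<phi> f = 0"
  using assms(3)
proof induction
  case (add_left x x' y)
  then show ?case by (simp add: contract_diff add hom_add distrib_left distrib_right)
next
  case (scale_left a x y)
  then show ?case by (simp add: contract_diff scale hom_mult mult.assoc)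
next
  case (smult f a)
  then show ?case by (simp add: map_times_eq contract_scale)
qed (simp_all add: contract_diff contract_add algebra_simps)

section \<open>Elements of the tensor product as cosets\<close>

abbreviation tcoset :: "('b tens \<Rightarrow>\<^sub>0 'a) \<Rightarrow> ('b tens \<Rightarrow>\<^sub>0 'a) set" where
  "tcoset f \<equiv> tensor_rels \<rho> +>\<^bsub>free_ring\<^esub> f"

lemma tcoset_eq_image: "tcoset f = (\<lambda>r. r + f) ` tensor_rels \<rho>"
  by (auto simp: a_r_coset_def r_coset_def free_ring_def)

lemma tcoset_eq_iff: "tcoset f = tcoset g \<longleftrightarrow> f - g \<in> tensor_rels \<rho>"
proof
  assume "tcoset f = tcoset g"
  moreover have "f \<in> tcoset f" using tensor_rels.zero by (force simp: tcoset_eq_image)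
  ultimately obtain r where "r \<in> tensor_rels \<rho>" "f = r + g" by (auto simp: tcoset_eq_image)
  then show "f - g \<in> tensor_rels \<rho>" by simp
next
  assume fg: "f - g \<in> tensor_rels \<rho>"
  have sub: "tcoset f \<subseteq> tcoset g" if fg: "f - g \<in> tensor_rels \<rho>" for f g
  proof
    fix h assume "h \<in> tcoset f"
    then obtain r where "r \<in> tensor_rels \<rho>" "h = r + f" by (auto simp: tcoset_eq_image)
    then have "r + (f - g) \<in> tensor_rels \<rho>" "h = r + (f - g) + g"
      using fg tensor_rels.add by auto
    then show "h \<in> tcoset g" unfolding tcoset_eq_image by blast
  qed
  have "g - f \<in> tensor_rels \<rho>" using tensor_rels_uminus[OF fg] by simp
  with fg sub show "tcoset f = tcoset g" by blast
qed

lemma carrier_tensor_ring: "carrier (tensor_ring \<rho>) = range tcoset"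
  by (auto simp: tensor_ring_def FactRing_def A_RCOSETS_def' free_ring_def)

lemma tcoset_in_carrier [simp]: "tcoset f \<in> carrier (tensor_ring \<rho>)"
  by (simp add: carrier_tensor_ring)

lemma tcoset_add: "tcoset f \<oplus>\<^bsub>tensor_ring \<rho>\<^esub> tcoset g = tcoset (f + g)"
proof -
  interpret I: ideal "tensor_rels \<rho>" free_ring by (rule ideal_tensor_rels)
  show ?thesis
    using I.a_rcos_sum[of f g] by (simp add: tensor_ring_def FactRing_def) (simp add: free_ring_def)
qed

lemma tcoset_mult: "tcoset f \<otimes>\<^bsub>tensor_ring \<rho>\<^esub> tcoset g = tcoset (f * g)"
proof -
  interpret I: ideal "tensor_rels \<rho>" free_ring by (rule ideal_tensor_rels)
  show ?thesis
    using I.rcoset_mult_add[of f g]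
    by (simp add: tensor_ring_def FactRing_def) (simp add: free_ring_def)
qed

lemma tcoset_zero: "\<zero>\<^bsub>tensor_ring \<rho>\<^esub> = tcoset 0"
  by (simp add: tensor_ring_def FactRing_def tcoset_eq_image)

lemma finsum_pure_tensor:
  assumes "finite I"
  shows "(\<Oplus>\<^bsub>tensor_ring \<rho>\<^esub> j\<in>I. pure_tensor \<rho> (u j) (v j)) = tcoset (\<Sum>j\<in>I. gen (u j) (v j) 1)"
proof -
  interpret T: cring "tensor_ring \<rho>" by (rule cring_tensor_ring)
  show ?thesis using assms
    by (induction I) (simp_all add: tcoset_zero pure_tensor_def tcoset_add)
qed

text \<open>Both \<open>gen y 1 1\<close> and \<open>gen 1 y 1\<close> are sent to \<open>y\<close>
  by \<open>free_mu\<close>, so their difference represents an element of J, which \<open>f\<close>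
  annihilates.\<close>

lemma annihilator_diag_ideal:
  assumes "tcoset f \<in> annihilator (tensor_ring \<rho>) (diag_ideal \<rho>)"
  shows "f * gen y 1 1 - f * gen 1 y 1 \<in> tensor_rels \<rho>"
proof -
  let ?g = "gen y 1 1 - gen 1 y 1 :: 'b tens \<Rightarrow>\<^sub>0 'a"
  have "tcoset ?g \<in> diag_ideal \<rho>"
    by (simp add: diag_ideal_def a_kernel_def' mu_coset free_mu_diff) (simp add: type_ring_def)
  with assms have "tcoset (f * ?g) = tcoset 0"
    by (auto simp: annihilator_def tcoset_mult tcoset_zero)
  then show ?thesis by (simp add: tcoset_eq_iff right_diff_distrib)
qed

text \<open>Expand the right factor of each generator in the basis and move the coefficients to the
  left factor. This supplies the family \<open>u\<close> when only membership in Ann(J) is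
  known.\<close>

lemma tcoset_eq_sum_basis:
  assumes e: "is_basis \<rho> n e"
  shows "\<exists>u. tcoset f = tcoset (\<Sum>j<n. gen (u j) (e j) 1)"
proof (induction f rule: poly_mapping_single_induct)
  case (single k a)
  obtain x y where k: "k = Tens x y" by (cases k)
  let ?c = "\<lambda>j. coords \<rho> n e y $ j"
  \<comment> \<open>With both summands 0, the additivity relation collapses to
    \<open>- gen x 0 1\<close>.\<close>
  have zero: "tcoset (gen x 0 1) = tcoset 0" for x
    using tensor_rels_uminus[OF tensor_rels.add_right[of x 0 0 \<rho>]] by (simp add: tcoset_eq_iff)
  have add: "tcoset (gen x (y + z) 1) = tcoset (gen x y 1) \<oplus>\<^bsub>tensor_ring \<rho>\<^esub> tcoset (gen x z 1)" for x y z
    using tensor_rels.add_right[of x y z \<rho>]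
    by (simp add: tcoset_add tcoset_eq_iff diff_diff_eq)
  have sum: "tcoset (gen x (\<Sum>j\<in>J. v j) 1) = tcoset (\<Sum>j\<in>J. gen x (v j) 1)"
    if "finite J" for J :: "nat set" and x v
    using that by induction (auto simp: zero add tcoset_add)
  \<comment> \<open>Both sides are congruent to \<open>gen x z b\<close>, by one scaling relation
    each.\<close>
  have swap: "tcoset (gen x (\<rho> b * z) 1) = tcoset (gen (\<rho> b * x) z 1)" for b x z
    using tensor_rels.add[OF tensor_rels.scale_right[of x \<rho> b z]
        tensor_rels_uminus[OF tensor_rels.scale_left[of \<rho> b x z]]]
    by (simp add: tcoset_eq_iff)
  have "tcoset (gen x y a) = tcoset (gen (\<rho> a * x) y 1)"
    using tensor_rels_uminus[OF tensor_rels.scale_left[of \<rho> a x y]] by (simp add: tcoset_eq_iff)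
  also have "\<dots> = tcoset (\<Sum>j<n. gen (\<rho> a * x) (\<rho> (?c j) * e j) 1)"
    using sum[of "{..<n}" "\<rho> a * x" "\<lambda>j. \<rho> (?c j) * e j"] by (simp add: coords_expand[OF e])
  also have "\<dots> = tcoset (\<Sum>j<n. gen (\<rho> (?c j) * (\<rho> a * x)) (e j) 1)"
    \<comment> \<open>Writing the coset of a sum as a sum of pure tensors in the quotient lets
      \<open>swap\<close> rewrite each summand.\<close>
    by (simp only: finsum_pure_tensor[symmetric] finite_lessThan pure_tensor_def swap)
  finally show ?case unfolding k by (rule exI[of _ "\<lambda>j. \<rho> (?c j) * (\<rho> a * x)"])
next
  case (sum f g)
  then obtain u v where "tcoset f = tcoset (\<Sum>j<n. gen (u j) (e j) 1)"
    "tcoset g = tcoset (\<Sum>j<n. gen (v j) (e j) 1)" by blast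
  then have "tcoset (f + g) = tcoset (\<Sum>j<n. gen (u j) (e j) 1 + gen (v j) (e j) 1)"
    by (simp add: tcoset_add[symmetric] sum.distrib)
  also have "\<dots> = tcoset (\<Sum>j<n. gen (u j + v j) (e j) 1)"
  proof -
    \<comment> \<open>The congruence is checked termwise: each difference is a relation up to sign,
      and relations are closed under sums.\<close>
    have "tcoset (gen (u j) (e j) 1 + gen (v j) (e j) 1) = tcoset (gen (u j + v j) (e j) 1)" for j
      using tensor_rels_uminus[OF tensor_rels.add_left[of "u j" "v j" "e j" \<rho>]]
      by (simp add: tcoset_eq_iff algebra_simps)
    then have "gen (u j) (e j) 1 + gen (v j) (e j) 1 - gen (u j + v j) (e j) 1 \<in> tensor_rels \<rho>" for j
      by (simp add: tcoset_eq_iff)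
    moreover have "(\<Sum>j\<in>J. r j) \<in> tensor_rels \<rho>" if "\<And>j. r j \<in> tensor_rels \<rho>"
      for r and J :: "nat set"
      by (induction J rule: infinite_finite_induct)
        (auto intro: that tensor_rels.zero tensor_rels.add)
    ultimately show ?thesis by (simp add: tcoset_eq_iff sum_subtractf[symmetric])
  qed
  finally show ?case by (rule exI[of _ "\<lambda>j. u j + v j"])
qed

section \<open>The trace and norm identities for elements of Ann(J)\<close>

lemma annihilator_trace_expansion:
  assumes e: "is_basis \<rho> n e"
    and ann: "tcoset (\<Sum>i<n. gen (u i) (e i) 1) \<in> annihilator (tensor_ring \<rho>) (diag_ideal \<rho>)"
  shows "(\<Sum>i<n. \<rho> (alg_trace \<rho> n (u i * x)) * e i) = (\<Sum>i<n. u i * e i) * x"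
proof -
  let ?c = "\<lambda>k y. coords \<rho> n e y $ k"
  have eq: "(\<Sum>i<n. \<rho> (?c k (u i * y)) * e i) = (\<Sum>i<n. \<rho> (?c k (u i)) * (e i * y))"
    if "k < n" for k y
  proof -
    \<comment> \<open>Contract \<open>?f * gen y 1 1 - ?f * gen 1 y 1\<close> with the k-th
      coordinate form: in the first product \<open>y\<close> enters the argument of the form, in the
      second it stays outside.\<close>
    let ?f = "\<Sum>i<n. gen (u i) (e i) 1 :: 'b tens \<Rightarrow>\<^sub>0 'a"
    have "contract (?c k) (?f * gen y 1 1 - ?f * gen 1 y 1) = 0"
      by (rule contract_tensor_rels)
        (use that in \<open>simp_all add: coords_add[OF e] coords_scale[OF e] annihilator_diag_ideal[OF ann]\<close>)
    then show ?thesis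
      by (simp add: contract_diff sum_distrib_right contract_sum mult_single plus_tens_def)
  qed
  have "(\<Sum>i<n. \<rho> (alg_trace \<rho> n (u i * x)) * e i) =
      (\<Sum>i<n. \<Sum>k<n. \<rho> (?c k (u i * (x * e k))) * e i)"
    by (simp add: alg_trace_eq[OF e] hom_sum sum_distrib_right mult.assoc)
  also have "\<dots> = (\<Sum>k<n. \<Sum>i<n. \<rho> (?c k (u i * (x * e k))) * e i)"
    by (rule sum.swap)
  also have "\<dots> = (\<Sum>k<n. \<Sum>i<n. \<rho> (?c k (u i)) * (e i * (x * e k)))"
    by (simp add: eq)
  also have "\<dots> = (\<Sum>i<n. \<Sum>k<n. \<rho> (?c k (u i)) * (e i * (x * e k)))"
    by (rule sum.swap)
  \<comment> \<open>Regrouped so that the inner sum over \<open>k\<close> is the basis expansion of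
    \<open>u i\<close>.\<close>
  also have "\<dots> = (\<Sum>i<n. (\<Sum>k<n. \<rho> (?c k (u i)) * e k) * (e i * x))"
    by (simp only: sum_distrib_right) (simp only: ac_simps)
  also have "\<dots> = (\<Sum>i<n. u i * e i) * x"
    by (simp add: coords_expand[OF e] sum_distrib_right mult.assoc)
  finally show ?thesis .
qed

lemma free_mu_sum: "free_mu \<rho> (\<Sum>i\<in>I. f i) = (\<Sum>i\<in>I. free_mu \<rho> (f i))"
  by (induction I rule: infinite_finite_induct) (auto simp: free_mu_add free_mu_def[of _ 0])

lemma mult_matrix_annihilator:
  assumes e: "is_basis \<rho> n e"
    and \<delta>: "\<delta> \<in> annihilator (tensor_ring \<rho>) (diag_ideal \<rho>)"
      "\<delta> = tcoset (\<Sum>i<n. gen (u i) (e i) 1)"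
  shows "mult_matrix \<rho> n e (mu \<rho> \<delta>) = mat n n (\<lambda>(i, j). alg_trace \<rho> n (u i * e j))"
proof -
  have "mu \<rho> \<delta> = (\<Sum>i<n. u i * e i)"
    by (simp add: \<delta>(2) mu_coset free_mu_sum)
  then have "mu \<rho> \<delta> * e j = (\<Sum>i<n. \<rho> (alg_trace \<rho> n (u i * e j)) * e i)" for j
    using annihilator_trace_expansion[OF e, of u "e j"] \<delta> by simp
  then show ?thesis
    by (auto simp: mult_matrix_def coords_unique[OF e] intro!: eq_matI)
qed

text \<open>Expand \<open>u i\<close> in the basis before multiplying by \<open>e j\<close>;
  linearity of the trace then pulls the coordinates out as the entries of the left factor.\<close>

lemma trace_matrix_expansion:
  assumes e: "is_basis \<rho> n e"
  shows "mat n n (\<lambda>(i, j). alg_trace \<rho> n (u i * e j)) =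
    mat n n (\<lambda>(i, j). coords \<rho> n e (u i) $ j) * trace_matrix \<rho> n e"
proof (rule eq_matI)
  have "alg_trace \<rho> n (u i * e j) = (\<Sum>k<n. coords \<rho> n e (u i) $ k * alg_trace \<rho> n (e k * e j))"
    for i j
    using alg_trace_lin_comb[OF e, of "\<lambda>k. coords \<rho> n e (u i) $ k" "\<lambda>k. e k * e j" "{..<n}"]
    by (simp add: mult.assoc[symmetric] sum_distrib_right[symmetric] coords_expand[OF e])
  then show "mat n n (\<lambda>(i, j). alg_trace \<rho> n (u i * e j)) $$ (i, j) =
      (mat n n (\<lambda>(i, j). coords \<rho> n e (u i) $ j) * trace_matrix \<rho> n e) $$ (i, j)"
    if "i < dim_row (mat n n (\<lambda>(i, j). coords \<rho> n e (u i) $ j) * trace_matrix \<rho> n e)"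
      "j < dim_col (mat n n (\<lambda>(i, j). coords \<rho> n e (u i) $ j) * trace_matrix \<rho> n e)" for i j
    using that by (simp add: trace_matrix_def scalar_prod_def lessThan_atLeast0)
qed (simp_all add: trace_matrix_def)

lemma alg_norm_annihilator:
  assumes e: "is_basis \<rho> n e"
    and \<delta>: "\<delta> \<in> annihilator (tensor_ring \<rho>) (diag_ideal \<rho>)"
      "\<delta> = tcoset (\<Sum>i<n. gen (u i) (e i) 1)"
  shows "alg_norm \<rho> n (mu \<rho> \<delta>) = mat_det (mat n n (\<lambda>(i, j). coords \<rho> n e (u i) $ j)) * disc \<rho> n e"
  unfolding alg_norm_eq[OF e] mult_matrix_annihilator[OF assms] trace_matrix_expansion[OF e] disc_def
  by (rule mat_det_mult[of _ n]) (simp_all add: trace_matrix_def)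

end

theorem mainTheorem3:
  fixes \<rho> :: "'a::{comm_ring,comm_monoid_mult} \<Rightarrow> 'b::{comm_ring,comm_monoid_mult}"
    and n :: nat and \<epsilon> :: "nat \<Rightarrow> 'b"
  assumes "comm_algebra \<rho>"
    and "is_basis \<rho> n \<epsilon>"
  shows
    "(\<forall>\<delta> \<in> annihilator (tensor_ring \<rho>) (diag_ideal \<rho>). \<forall>u :: nat \<Rightarrow> 'b.
        \<delta> = (\<Oplus>\<^bsub>tensor_ring \<rho>\<^esub> j\<in>{..<n}. pure_tensor \<rho> (u j) (\<epsilon> j)) \<longrightarrow>
        (let b = mu \<rho> \<delta>;
             P = mat n n (\<lambda>(i, j). coords \<rho> n \<epsilon> (u i) $ j)
         in mult_matrix \<rho> n \<epsilon> b = mat n n (\<lambda>(i, j). alg_trace \<rho> n (u i * \<epsilon> j))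
          \<and> mat n n (\<lambda>(i, j). alg_trace \<rho> n (u i * \<epsilon> j)) = P * trace_matrix \<rho> n \<epsilon>
          \<and> alg_norm \<rho> n b = mat_det P * disc \<rho> n \<epsilon>))
   \<and> (\<forall>b \<in> mu \<rho> ` annihilator (tensor_ring \<rho>) (diag_ideal \<rho>). disc \<rho> n \<epsilon> dvd alg_norm \<rho> n b)"
proof (intro conjI ballI allI impI)
  interpret comm_algebra \<rho> by fact
  note e = \<open>is_basis \<rho> n \<epsilon>\<close>
  {
    fix \<delta> and u :: "nat \<Rightarrow> 'b"
    assume ann: "\<delta> \<in> annihilator (tensor_ring \<rho>) (diag_ideal \<rho>)"
      and "\<delta> = (\<Oplus>\<^bsub>tensor_ring \<rho>\<^esub> j\<in>{..<n}. pure_tensor \<rho> (u j) (\<epsilon> j))"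
    then have \<delta>: "\<delta> = tcoset (\<Sum>j<n. gen (u j) (\<epsilon> j) 1)"
      by (simp add: finsum_pure_tensor)
    show "let b = mu \<rho> \<delta>; P = mat n n (\<lambda>(i, j). coords \<rho> n \<epsilon> (u i) $ j)
      in mult_matrix \<rho> n \<epsilon> b = mat n n (\<lambda>(i, j). alg_trace \<rho> n (u i * \<epsilon> j))
       \<and> mat n n (\<lambda>(i, j). alg_trace \<rho> n (u i * \<epsilon> j)) = P * trace_matrix \<rho> n \<epsilon>
       \<and> alg_norm \<rho> n b = mat_det P * disc \<rho> n \<epsilon>"
      unfolding Let_def
      by (intro conjI mult_matrix_annihilator[OF e ann \<delta>] trace_matrix_expansion[OF e]
          alg_norm_annihilator[OF e ann \<delta>])
  }
  fix b assume "b \<in> mu \<rho> ` annihilator (tensor_ring \<rho>) (diag_ideal \<rho>)"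
  then obtain \<delta> where ann: "\<delta> \<in> annihilator (tensor_ring \<rho>) (diag_ideal \<rho>)" and b: "b = mu \<rho> \<delta>"
    by blast
  then obtain f where "\<delta> = tcoset f"
    by (auto simp: annihilator_def carrier_tensor_ring)
  \<comment> \<open>Here \<delta> comes without an expansion, so one is chosen; the determinant of
    its coordinate matrix is the cofactor in the divisibility.\<close>
  then obtain u where "\<delta> = tcoset (\<Sum>j<n. gen (u j) (\<epsilon> j) 1)"
    using tcoset_eq_sum_basis[OF e] by metis
  from alg_norm_annihilator[OF e ann this] show "disc \<rho> n \<epsilon> dvd alg_norm \<rho> n b"
    unfolding b by (metis dvdI mult.commute)
qed

end
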